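(* Let $R$ be an associative ring with unity $1$, and let $p, q \in R$ be idempotents (i.e. $p^2=p$ and $q^2=q$). Then the following statements are equivalent: (1) $pq-qp\in R^D$; (2) $pq\in R^D$ and $p-q\in R^D$.
   Context: An element $a\in R$ is Drazin invertible if there exists $b\in R$ such that $ab=ba$, $bab=b$, and $a^k=a^{k+1}b$ for some positive integer $k$; such $b$ is unique if it exists and is denoted $a^D$. $R^D$ denotes the set of all Drazin invertible elements of $R$. The ring $R$ is not assumed commutative. *)

theory Defs
  imports Main
begin

text \<open>
  The sort \<open>{ring, monoid_mult}\<close> describes associative, not necessarily commutative rings with
  unity. The class \<open>ring_1\<close> would additionally impose \<open>0 \<noteq> 1\<close>, excluding the zero ring.
\<close>

definition is_drazin_inverse :: "'a::{ring, monoid_mult} \<Rightarrow> 'a \<Rightarrow> bool" where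
  "is_drazin_inverse a b \<longleftrightarrow>
     a * b = b * a \<and> b * a * b = b \<and> (\<exists>k::nat. 0 < k \<and> a ^ k = a ^ (k + 1) * b)"

definition drazin_invertibles :: "'a::{ring, monoid_mult} set" where
  "drazin_invertibles = {a. \<exists>b. is_drazin_inverse a b}"

end

theory Submission
  imports Defs
begin

text \<open>
  Put \<open>a = p - q\<close>, \<open>x = a\<^sup>2\<close>, \<open>w = 1 - x\<close>. Then \<open>x\<close> and \<open>w\<close> commute with \<open>p\<close> and \<open>q\<close>, and
  \<open>(p * q - q * p)\<^sup>2 = - (x * w)\<close>, \<open>p * w = p * q * p\<close>, \<open>q * w = q * p * q\<close>.
  Drazin invertibility passes between an element and its square and, by Cline's formula, between
  \<open>p * q\<close>, \<open>p * w\<close> and \<open>q * w\<close>. If \<open>x * w\<close> is Drazin invertible, so are \<open>x\<close> and \<open>w\<close>, because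
  their powers are comaximal. Conversely, \<open>a * q = (1 - p) * a\<close> transports the Drazin
  invertibility of \<open>q * w\<close> to \<open>(1 - p) * w\<close> up to a factor \<open>x\<close>; adding \<open>p * w\<close> yields that of
  \<open>x * w\<close>.
\<close>

section \<open>Power equations and the commutant of a Drazin inverse\<close>

lemma power_mult_commuting:
  fixes a b :: "'a::monoid_mult"
  assumes "a * b = b * a"
  shows "(a * b) ^ n = a ^ n * b ^ n"
proof (induction n)
  case (Suc n)
  have "(a * b) ^ Suc n = a * (b * a ^ n) * b ^ n"
    using Suc by (simp add: mult.assoc)
  also have "b * a ^ n = a ^ n * b"
    using assms by (simp add: power_commuting_commutes)
  finally show ?case
    by (simp add: mult.assoc)
qed simp

lemma power_eq_power_add_mult_power:
  fixes a s :: "'a::monoid_mult"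
  assumes comm: "a * s = s * a" and k: "a ^ k = a ^ (k + 1) * s" and "k \<le> n"
  shows "a ^ n = a ^ (n + j) * s ^ j"
proof (induction j)
  case (Suc j)
  have "k \<le> n + j"
    using \<open>k \<le> n\<close> by simp
  then have "a ^ (n + j) = a ^ (n + j - k) * (a ^ (k + 1) * s)"
    unfolding k[symmetric] by (simp flip: power_add)
  also have "\<dots> = a ^ (n + Suc j) * s"
    using \<open>k \<le> n + j\<close> by (simp add: mult.assoc[symmetric] flip: power_add power_Suc power_Suc2)
  finally show ?case
    using Suc by (metis mult.assoc power_Suc)
qed simp

text \<open>The witness \<open>s\<close> is corrected to \<open>b = a ^ k * s ^ (k + 1)\<close>.
  Since all factors commute, \<open>b * a * b\<close> is
  \<open>a ^ (2 * k + 1) * s ^ (2 * k + 2)\<close>, and iterating the power equation collapses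
  \<open>a ^ (2 * k + 1) * s ^ (k + 1)\<close> to \<open>a ^ k\<close>.\<close>

lemma drazin_invertiblesI:
  fixes a s :: "'a::{ring, monoid_mult}"
  assumes comm: "a * s = s * a" and k: "a ^ k = a ^ (k + 1) * s"
  shows "a \<in> drazin_invertibles"
proof -
  define b where "b = a ^ k * s ^ (k + 1)"
  have sa: "s ^ m * a ^ n = a ^ n * s ^ m" for m n
    using comm by (metis power_commuting_commutes)
  have eq: "a ^ n = a ^ (n + j) * s ^ j" if "k \<le> n" for n j
    using power_eq_power_add_mult_power[OF comm k that] .
  have ab: "a * b = a ^ (k + 1) * s ^ (k + 1)"
    by (simp add: b_def mult.assoc)
  have "b * a = a ^ k * (s ^ (k + 1) * a ^ 1)"
    by (simp only: b_def mult.assoc power_one_right)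
  then have ba: "b * a = a ^ (k + 1) * s ^ (k + 1)"
    unfolding sa by (simp only: mult.assoc power_add)
  have "b * a * b = a ^ (k + 1) * (s ^ (k + 1) * a ^ k) * s ^ (k + 1)"
    unfolding ba by (simp only: b_def mult.assoc)
  also have "\<dots> = a ^ (k + 1) * a ^ k * (s ^ (k + 1) * s ^ (k + 1))"
    unfolding sa by (simp only: mult.assoc)
  also have "a ^ (k + 1) * a ^ k = a ^ (k + (k + 1))"
    by (metis add.commute power_add)
  also have "a ^ (k + (k + 1)) * (s ^ (k + 1) * s ^ (k + 1)) = b"
    unfolding b_def mult.assoc[symmetric] eq[of k "k + 1", symmetric, OF order_refl] ..
  finally have bab: "b * a * b = b" .
  have "a ^ (k + 1 + 1) * b = a ^ (k + 1) * (a * b)"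
    by (simp only: power_add power_one_right mult.assoc)
  also have "\<dots> = a ^ (k + 1 + (k + 1)) * s ^ (k + 1)"
    unfolding ab by (simp only: mult.assoc power_add)
  also have "\<dots> = a ^ (k + 1)"
    using eq[of "k + 1" "k + 1"] by simp
  finally have "a ^ (k + 1) = a ^ (k + 1 + 1) * b" ..
  \<comment> \<open>The index \<open>k + 1\<close> is positive even for \<open>k = 0\<close>, the
    case that serves the unit \<open>- 1\<close> later.\<close>
  moreover have "0 < k + 1"
    by simp
  ultimately have "\<exists>n>0. a ^ n = a ^ (n + 1) * b"
    by (intro exI[of _ "k + 1"] conjI)
  moreover have "a * b = b * a"
    unfolding ab ba ..
  ultimately have "is_drazin_inverse a b"
    unfolding is_drazin_inverse_def using bab by (intro conjI)
  then show ?thesis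
    unfolding drazin_invertibles_def by (intro CollectI exI)
qed

text \<open>The idempotent \<open>e = a * b\<close> equals both \<open>a ^ k * b ^ k\<close> and
  \<open>b ^ k * a ^ k\<close>, and it fixes \<open>a ^ k\<close> on either side. Moving
  \<open>x\<close> past \<open>a ^ k\<close> therefore shows that \<open>e * x\<close> and
  \<open>x * e\<close> both equal \<open>e * x * e\<close>. Then
  \<open>b * x = b * x * (a * b) = e * x * b = x * b\<close>.\<close>

lemma drazin_inverse_double_commutant:
  fixes a b x :: "'a::{ring, monoid_mult}"
  assumes "is_drazin_inverse a b" and ax: "a * x = x * a"
  shows "b * x = x * b"
proof -
  from assms obtain k where ab: "a * b = b * a" and bab: "b * a * b = b"
    and k: "0 < k" "a ^ k = a ^ (k + 1) * b"
    unfolding is_drazin_inverse_def by blast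
  define e where "e = a * b"
  have ee: "e * e = e"
    unfolding e_def using bab by (simp add: mult.assoc)
  have "e ^ n = e" if "0 < n" for n
    using that by (induction n rule: nat_induct_non_zero) (simp_all add: ee)
  then have e1: "e = a ^ k * b ^ k"
    using k(1) power_mult_commuting[OF ab, of k] by (simp add: e_def)
  have e2: "e = b ^ k * a ^ k"
    using e1 ab by (metis power_commuting_commutes)
  have xk: "a ^ k * x = x * a ^ k"
    using ax by (metis power_commuting_commutes)
  have ake: "a ^ k * e = a ^ k"
    unfolding e_def using k(2) by (metis mult.assoc power_Suc2 Suc_eq_plus1)
  have eak: "e * a ^ k = a ^ k"
    using ake unfolding e_def using ab by (metis mult.assoc power_commuting_commutes)
  have "e * x = b ^ k * (x * a ^ k)"
    unfolding e2 by (simp add: mult.assoc xk)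
  also have "\<dots> = b ^ k * (x * a ^ k) * e"
    by (simp add: mult.assoc ake)
  also have "\<dots> = e * x * e"
    unfolding xk[symmetric] by (simp add: e2 mult.assoc)
  finally have *: "e * x = e * x * e" .
  have "x * e = a ^ k * x * b ^ k"
    unfolding e1 by (simp add: mult.assoc[symmetric] xk)
  also have "\<dots> = e * (a ^ k * x * b ^ k)"
    by (simp add: mult.assoc[symmetric] eak)
  also have "\<dots> = e * x * e"
    by (simp add: xk e1 mult.assoc)
  finally have ex: "e * x = x * e"
    using * by simp
  have be: "b * e = b"
    using bab by (simp add: e_def mult.assoc)
  have eb: "e * b = b"
    using bab ab by (simp add: e_def)
  have "b * x = b * (e * x)"
    by (simp add: be mult.assoc[symmetric])
  also have "\<dots> = b * (x * a) * b"
    unfolding ex by (simp only: e_def mult.assoc)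
  also have "\<dots> = (e * x) * b"
    unfolding ax[symmetric] e_def ab by (simp only: mult.assoc)
  also have "\<dots> = x * b"
    unfolding ex by (simp add: eb mult.assoc)
  finally show ?thesis .
qed

text \<open>The working form of the hypothesis: any number of factors \<open>s\<close> can be split
  off a high power, and \<open>s\<close> commutes with whatever commutes with
  \<open>a\<close>.\<close>

lemma drazin_invertiblesE:
  fixes a :: "'a::{ring, monoid_mult}"
  assumes "a \<in> drazin_invertibles"
  obtains k s where "\<And>n j. k \<le> n \<Longrightarrow> a ^ n = a ^ (n + j) * s ^ j"
    and "\<And>x. a * x = x * a \<Longrightarrow> s * x = x * s"
proof -
  from assms obtain s where s: "is_drazin_inverse a s"
    unfolding drazin_invertibles_def by blast
  then obtain k where "a * s = s * a" "a ^ k = a ^ (k + 1) * s"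
    unfolding is_drazin_inverse_def by blast
  then show ?thesis
    using that power_eq_power_add_mult_power drazin_inverse_double_commutant[OF s] by metis
qed

section \<open>Closure under commuting products, negation, squares and swaps\<close>

lemma drazin_invertibles_mult_commuting:
  fixes a b :: "'a::{ring, monoid_mult}"
  assumes a: "a \<in> drazin_invertibles" and b: "b \<in> drazin_invertibles" and ab: "a * b = b * a"
  shows "a * b \<in> drazin_invertibles"
proof -
  obtain k s where k: "\<And>n j. k \<le> n \<Longrightarrow> a ^ n = a ^ (n + j) * s ^ j"
    and s: "\<And>x. a * x = x * a \<Longrightarrow> s * x = x * s"
    using drazin_invertiblesE[OF a] by metis
  obtain l t where l: "\<And>n j. l \<le> n \<Longrightarrow> b ^ n = b ^ (n + j) * t ^ j"
    and t: "\<And>x. b * x = x * b \<Longrightarrow> t * x = x * t"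
    using drazin_invertiblesE[OF b] by metis
  have sa: "s * a = a * s" and sb: "s * b = b * s"
    using s ab by auto
  have tb: "t * b = b * t" and ta: "t * a = a * t"
    using t ab by auto
  show ?thesis
  proof (rule drazin_invertiblesI)
    show "a * b * (s * t) = s * t * (a * b)"
      by (metis mult.assoc sa sb ta tb)
    have "(a * b) ^ (k + l) = a ^ (k + l) * b ^ (k + l)"
      by (rule power_mult_commuting[OF ab])
    also have "\<dots> = a ^ (k + l + 1) * s * (b ^ (k + l + 1) * t)"
      using k[of "k + l" 1] l[of "k + l" 1] by simp
    also have "\<dots> = a ^ (k + l + 1) * (s * b ^ (k + l + 1)) * t"
      by (simp only: mult.assoc)
    also have "s * b ^ (k + l + 1) = b ^ (k + l + 1) * s"
      using sb by (metis power_commuting_commutes)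
    also have "a ^ (k + l + 1) * (b ^ (k + l + 1) * s) * t = (a * b) ^ (k + l + 1) * (s * t)"
      by (simp only: mult.assoc power_mult_commuting[OF ab])
    finally show "(a * b) ^ (k + l) = (a * b) ^ (k + l + 1) * (s * t)" .
  qed
qed

lemma drazin_invertibles_uminus:
  fixes a :: "'a::{ring, monoid_mult}"
  assumes "a \<in> drazin_invertibles"
  shows "- a \<in> drazin_invertibles"
proof -
  have "(- 1 :: 'a) \<in> drazin_invertibles"
    by (rule drazin_invertiblesI[where s = "- 1" and k = 0]) simp_all
  from drazin_invertibles_mult_commuting[OF this assms] show ?thesis
    by simp
qed

lemma drazin_invertibles_idempotent:
  fixes p :: "'a::{ring, monoid_mult}"
  assumes "p * p = p"
  shows "p \<in> drazin_invertibles"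
  by (rule drazin_invertiblesI[where s = p and k = 1]) (simp_all add: assms)

text \<open>If \<open>s\<close> serves for \<open>a * a\<close>, then \<open>a * s\<close> serves
  for \<open>a\<close>: \<open>s\<close> commutes with \<open>a\<close> because \<open>a\<close>
  commutes with its square.\<close>

lemma drazin_invertibles_square_iff:
  fixes a :: "'a::{ring, monoid_mult}"
  shows "a * a \<in> drazin_invertibles \<longleftrightarrow> a \<in> drazin_invertibles"
proof
  assume "a * a \<in> drazin_invertibles"
  then obtain k s where k: "\<And>n j. k \<le> n \<Longrightarrow> (a * a) ^ n = (a * a) ^ (n + j) * s ^ j"
    and s: "\<And>x. a * a * x = x * (a * a) \<Longrightarrow> s * x = x * s"
    using drazin_invertiblesE by metis
  have sa: "s * a = a * s"
    by (rule s) (simp add: mult.assoc)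
  have aa: "(a * a) ^ n = a ^ (2 * n)" for n
    by (simp add: power_mult power2_eq_square)
  have "a ^ (2 * k) = a ^ (2 * k + 2) * s"
    using k[of k 1] unfolding aa by simp
  also have "a ^ (2 * k + 2) = a ^ (2 * k + 1) * a"
    using power_Suc2[of a "2 * k + 1"] by (simp del: power_Suc power_Suc2)
  finally show "a \<in> drazin_invertibles"
    by (intro drazin_invertiblesI[where s = "a * s" and k = "2 * k"])
      (simp_all add: sa mult.assoc)
qed (simp add: drazin_invertibles_mult_commuting)

text \<open>Cline's formula.\<close>

lemma drazin_invertibles_mult_swap:
  fixes a b :: "'a::{ring, monoid_mult}"
  assumes "a * b \<in> drazin_invertibles"
  shows "b * a \<in> drazin_invertibles"
proof -
  obtain k s where k: "\<And>n j. k \<le> n \<Longrightarrow> (a * b) ^ n = (a * b) ^ (n + j) * s ^ j"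
    and s: "\<And>x. a * b * x = x * (a * b) \<Longrightarrow> s * x = x * s"
    using drazin_invertiblesE[OF assms] by metis
  have sab: "s * (a * b) = a * b * s"
    by (rule s) simp
  have swap: "(b * a) ^ n * b = b * (a * b) ^ n" for n
    by (induction n) (simp_all add: mult.assoc)
  show ?thesis
  proof (rule drazin_invertiblesI)
    \<comment> \<open>The witness \<open>b * s ^ 2 * a\<close> is Cline's expression. The index
      rises by one because \<open>(b * a) ^ (k + 1)\<close> is \<open>(a * b) ^ k\<close> enclosed
      between \<open>b\<close> and \<open>a\<close>.\<close>
    show "b * a * (b * s ^ 2 * a) = b * s ^ 2 * a * (b * a)"
      using sab by (simp add: power2_eq_square) (metis mult.assoc)
    have "(b * a) ^ (k + 1) = b * (a * b) ^ k * a"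
      unfolding swap[symmetric] by (simp add: mult.assoc power_commutes)
    also have "\<dots> = b * (a * b) ^ (k + 2) * (s ^ 2 * a)"
      using k[of k 2] by (simp only: mult.assoc order_refl)
    also have "\<dots> = (b * a) ^ (k + 1 + 1) * (b * s ^ 2 * a)"
      unfolding swap[symmetric] by (simp add: mult.assoc)
    finally show "(b * a) ^ (k + 1) = (b * a) ^ (k + 1 + 1) * (b * s ^ 2 * a)" .
  qed
qed

section \<open>Comaximality of \<open>x\<close> and \<open>1 - x\<close>\<close>

lemma power_one_minus_comaximal:
  fixes x :: "'a::{ring, monoid_mult}"
  obtains u where "(1 - x) ^ n = 1 - x * u" and "x * u = u * x"
proof -
  have "\<exists>u. (1 - x) ^ n = 1 - x * u \<and> x * u = u * x"
  proof (induction n)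
    case 0
    show ?case
      by (intro exI[of _ 0]) simp
  next
    case (Suc n)
    then obtain u where u: "(1 - x) ^ n = 1 - x * u" and ux: "u * x = x * u"
      by metis
    have ux': "u * (x * y) = x * (u * y)" for y
      using ux by (metis mult.assoc)
    show ?case
      unfolding power_Suc u
      \<comment> \<open>The new cofactor is read off from
        \<open>(1 - x) * (1 - x * u) = 1 - x * (1 + u - x * u)\<close>.\<close>
      by (intro exI[of _ "1 + u - x * u"]) (simp add: algebra_simps ux ux')
  qed
  then show ?thesis
    using that by blast
qed

text \<open>Multiplying \<open>1 = x * u + w ^ k\<close> by \<open>x ^ k\<close> leaves two terms
  divisible by \<open>x ^ (k + 1)\<close>: the first visibly, the second because
  \<open>x ^ k * w ^ k = (x * w) ^ k = (x * w) ^ (k + 1) * s\<close>.\<close>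

lemma drazin_invertibles_mult_one_minusD:
  fixes x :: "'a::{ring, monoid_mult}"
  assumes "x * (1 - x) \<in> drazin_invertibles"
  shows "x \<in> drazin_invertibles"
proof -
  define w where "w = 1 - x"
  have xw: "x * w = w * x"
    by (simp add: w_def algebra_simps)
  obtain k s where k: "\<And>n j. k \<le> n \<Longrightarrow> (x * w) ^ n = (x * w) ^ (n + j) * s ^ j"
    and s: "\<And>y. x * w * y = y * (x * w) \<Longrightarrow> s * y = y * s"
    using drazin_invertiblesE[OF assms] unfolding w_def by metis
  have sx: "s * x = x * s"
    by (rule s) (metis xw mult.assoc)
  obtain u where u: "w ^ k = 1 - x * u" "x * u = u * x"
    unfolding w_def by (rule power_one_minus_comaximal)
  have xwk: "x * w ^ (k + 1) = w ^ (k + 1) * x"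
    using xw by (metis power_commuting_commutes)
  show ?thesis
  proof (rule drazin_invertiblesI)
    show "x * (u + w ^ (k + 1) * s) = (u + w ^ (k + 1) * s) * x"
      unfolding distrib_left distrib_right u(2) by (metis mult.assoc sx xwk)
    have "x ^ k = x ^ k * (x * u) + x ^ k * w ^ k"
      unfolding u(1) by (simp add: right_diff_distrib)
    also have "x ^ k * w ^ k = x ^ (k + 1) * w ^ (k + 1) * s"
      using k[of k 1] power_mult_commuting[OF xw] by (simp del: power_Suc)
    also have "x ^ k * (x * u) = x ^ (k + 1) * u"
      by (simp add: mult.assoc[symmetric] power_commutes)
    finally show "x ^ k = x ^ (k + 1) * (u + w ^ (k + 1) * s)"
      by (simp add: distrib_left mult.assoc)
  qed
qed

section \<open>Pairs of idempotents\<close>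

lemma idempotents_difference:
  fixes p q :: "'a::{ring, monoid_mult}"
  assumes p: "p * p = p" and q: "q * q = q"
  defines "a \<equiv> p - q"
  defines "x \<equiv> a * a"
  shows "(p * q - q * p) * (p * q - q * p) = - (x * (1 - x))"
    and "x * p = p * x" and "x * q = q * x"
    and "p * (1 - x) = p * q * p" and "q * (1 - x) = q * p * q"
    and "a * q = (1 - p) * a"
proof -
  \<comment> \<open>Products are normalised to right-nested words, so idempotency must also apply in
    front of a tail \<open>z\<close>.\<close>
  have p': "p * (p * z) = p * z" and q': "q * (q * z) = q * z" for z
    using p q by (simp_all add: mult.assoc[symmetric])
  note r = a_def x_def p q p' q'
  show "(p * q - q * p) * (p * q - q * p) = - (x * (1 - x))"
    and "x * p = p * x" and "x * q = q * x"
    and "p * (1 - x) = p * q * p" and "q * (1 - x) = q * p * q"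
    and "a * q = (1 - p) * a"
    by (simp_all add: r algebra_simps)
qed

lemma drazin_invertibles_idempotents_difference_square:
  fixes p q :: "'a::{ring, monoid_mult}"
  assumes p: "p * p = p" and q: "q * q = q"
  defines "x \<equiv> (p - q) * (p - q)"
  assumes pq: "p * q \<in> drazin_invertibles" and x: "x \<in> drazin_invertibles"
  shows "x * (1 - x) \<in> drazin_invertibles"
proof -
  define a w where "a = p - q" and "w = 1 - x"
  note id = idempotents_difference[OF p q, folded x_def a_def, folded x_def w_def]
  have xw: "x * w = w * x"
    by (simp add: w_def algebra_simps)
  have pw: "p * w = w * p" and qw: "q * w = w * q"
    using id(2,3) by (simp_all add: w_def algebra_simps)
  have ax: "a * x = x * a"
    by (simp add: a_def x_def mult.assoc)
  have aw: "a * w = w * a"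
    using ax by (simp add: w_def algebra_simps)
  have "p * w \<in> drazin_invertibles"
    using drazin_invertibles_mult_swap[of p "p * q"] pq p id(4) by (simp add: mult.assoc[symmetric])
  then obtain k z where k: "\<And>n j. k \<le> n \<Longrightarrow> (p * w) ^ n = (p * w) ^ (n + j) * z ^ j"
    and z: "\<And>y. p * w * y = y * (p * w) \<Longrightarrow> z * y = y * z"
    using drazin_invertiblesE by metis
  have "q * w \<in> drazin_invertibles"
    using drazin_invertibles_mult_swap[of "p * q" q] pq q id(5) by (simp add: mult.assoc)
  then obtain l t where l: "\<And>n j. l \<le> n \<Longrightarrow> (q * w) ^ n = (q * w) ^ (n + j) * t ^ j"
    and t: "\<And>y. q * w * y = y * (q * w) \<Longrightarrow> t * y = y * t"
    using drazin_invertiblesE by metis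
  obtain m d where m: "\<And>n j. m \<le> n \<Longrightarrow> x ^ n = x ^ (n + j) * d ^ j"
    and d: "\<And>y. x * y = y * x \<Longrightarrow> d * y = y * d"
    using drazin_invertiblesE[OF x] by metis
  have zx: "z * x = x * z"
    by (rule z) (metis id(2) mult.assoc xw)
  have zw: "z * w = w * z"
    by (rule z) (metis pw mult.assoc)
  have tx: "t * x = x * t"
    by (rule t) (metis id(3) mult.assoc xw)
  have tw: "t * w = w * t"
    by (rule t) (metis qw mult.assoc)
  have dx: "d * x = x * d" and dw: "d * w = w * d"
    using d xw by auto
  \<comment> \<open>One exponent for all three power equations; the \<open>+ 1\<close> keeps it
    positive, so that \<open>e ^ N = e\<close> for an idempotent \<open>e\<close>.\<close>
  define N where "N = k + l + m + 1"
  have N: "k \<le> N" "l \<le> N" "0 < N"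
    by (simp_all add: N_def)
  \<comment> \<open>The first summand handles \<open>p * w ^ N * x\<close>; the second,
    \<open>q * t\<close> enclosed between two copies of \<open>a\<close>, handles
    \<open>(1 - p) * w ^ N * x\<close>.\<close>
  define s where "s = p * z * x + a * q * t * a"
  have pow: "(e * w) ^ n = e * w ^ n" if "e * e = e" "e * w = w * e" "0 < n" for e n
  proof -
    have "e ^ n = e"
      using that(3) by (induction n rule: nat_induct_non_zero) (simp_all add: that(1))
    then show ?thesis
      using power_mult_commuting[OF that(2), of n] by simp
  qed
  have wp: "w ^ n * p = p * w ^ n" and wa: "w ^ n * a = a * w ^ n" for n
    using pw aw by (metis power_commuting_commutes)+
  have 1: "p * w ^ N = p * w ^ (N + 1) * z"
    using k[OF N(1), of 1] pow[OF p pw N(3)] pow[OF p pw, of "N + 1"] by (simp del: power_Suc)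
  have 2: "q * w ^ N = q * w ^ (N + 1) * t"
    using l[OF N(2), of 1] pow[OF q qw N(3)] pow[OF q qw, of "N + 1"] by (simp del: power_Suc)
  \<comment> \<open>Splitting \<open>x = a * a\<close> puts one \<open>a\<close> next to
    \<open>1 - p\<close>, where \<open>(1 - p) * a = a * q\<close> brings in
    \<open>q * w ^ N\<close>.\<close>
  have "(1 - p) * w ^ N * x = (1 - p) * a * w ^ N * a"
    unfolding x_def a_def[symmetric] by (metis wa mult.assoc)
  also have "\<dots> = a * (q * w ^ N) * a"
    by (simp only: id(6) mult.assoc flip: id(6))
  also have "\<dots> = w ^ (N + 1) * (a * q * t * a)"
    unfolding 2 using wa[of "N + 1"] power_commuting_commutes[OF qw[symmetric], of "N + 1"]
    by (metis mult.assoc)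
  finally have 3: "(1 - p) * w ^ N * x = w ^ (N + 1) * (a * q * t * a)" .
  have "w ^ N * x = p * w ^ N * x + (1 - p) * w ^ N * x"
    by (simp add: algebra_simps)
  also have "p * w ^ N * x = w ^ (N + 1) * (p * z * x)"
    unfolding 1 by (metis wp mult.assoc)
  finally have wNx: "w ^ N * x = w ^ (N + 1) * s"
    unfolding 3 s_def distrib_left .
  have sx: "s * x = x * s"
  proof -
    have "p * z * x * x = x * (p * z * x)"
      by (metis zx id(2) mult.assoc)
    moreover have "a * q * t * a * x = x * (a * q * t * a)"
      by (metis ax tx id(3) mult.assoc)
    ultimately show ?thesis
      by (simp only: s_def distrib_left distrib_right)
  qed
  then have sw: "s * w = w * s"
    by (simp add: w_def algebra_simps)
  show ?thesis
    unfolding w_def[symmetric]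
  proof (rule drazin_invertiblesI)
    show "x * w * (s * d ^ 2) = s * d ^ 2 * (x * w)"
      unfolding power2_eq_square by (metis dx dw sx sw mult.assoc)
    have "(x * w) ^ N = w ^ N * x ^ N"
      using power_mult_commuting[OF xw[symmetric]] xw by metis
    \<comment> \<open>Two extra factors \<open>x\<close> are created: one is consumed with
      \<open>w ^ N\<close> by \<open>wNx\<close>, the other raises the exponent to
      \<open>N + 1\<close>.\<close>
    also have "\<dots> = w ^ N * (x ^ (N + 2) * d ^ 2)"
      using m[of N 2] by (simp add: N_def)
    also have "\<dots> = (w ^ N * x) * x ^ (N + 1) * d ^ 2"
      by (simp add: mult.assoc)
    also have "\<dots> = w ^ (N + 1) * (s * x ^ (N + 1)) * d ^ 2"
      by (simp only: wNx mult.assoc)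
    also have "s * x ^ (N + 1) = x ^ (N + 1) * s"
      using sx by (metis power_commuting_commutes)
    also have "w ^ (N + 1) * (x ^ (N + 1) * s) * d ^ 2 = (x * w) ^ (N + 1) * (s * d ^ 2)"
      unfolding xw power_mult_commuting[OF xw[symmetric]] by (simp only: mult.assoc)
    finally show "(x * w) ^ N = (x * w) ^ (N + 1) * (s * d ^ 2)" .
  qed
qed

theorem theorem3p5:
  fixes p q :: "'a::{ring, monoid_mult}"
  assumes "p ^ 2 = p" and "q ^ 2 = q"
  shows "p * q - q * p \<in> drazin_invertibles \<longleftrightarrow>
    p * q \<in> drazin_invertibles \<and> p - q \<in> drazin_invertibles"
proof -
  have p: "p * p = p" and q: "q * q = q"
    using assms by (simp_all add: power2_eq_square)
  define x where "x = (p - q) * (p - q)"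
  note id = idempotents_difference[OF p q, folded x_def]
  have c: "p * q - q * p \<in> drazin_invertibles \<longleftrightarrow> x * (1 - x) \<in> drazin_invertibles"
    using drazin_invertibles_square_iff[of "p * q - q * p"] id(1) drazin_invertibles_uminus
    by (metis minus_minus)
  have a: "p - q \<in> drazin_invertibles \<longleftrightarrow> x \<in> drazin_invertibles"
    unfolding x_def drazin_invertibles_square_iff ..
  have "p * q \<in> drazin_invertibles \<and> x \<in> drazin_invertibles"
    if y: "x * (1 - x) \<in> drazin_invertibles"
  proof
    show "x \<in> drazin_invertibles"
      using drazin_invertibles_mult_one_minusD[OF y] .
    \<comment> \<open>The product \<open>x * (1 - x)\<close> is symmetric under \<open>x\<close> and
      \<open>1 - x\<close>, so the same lemma covers \<open>1 - x\<close>.\<close>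
    have "(1 - x) * (1 - (1 - x)) = x * (1 - x)"
      by (simp add: algebra_simps)
    then have "1 - x \<in> drazin_invertibles"
      using drazin_invertibles_mult_one_minusD[of "1 - x"] y by simp
    moreover have "p * (1 - x) = (1 - x) * p"
      using id(2) by (simp add: algebra_simps)
    ultimately have "p * q * p \<in> drazin_invertibles"
      using drazin_invertibles_mult_commuting drazin_invertibles_idempotent[OF p] id(4) by metis
    \<comment> \<open>Swapping the factors \<open>p * q\<close> and \<open>p\<close> turns
      \<open>p * q * p\<close> into \<open>p * (p * q) = p * q\<close>.\<close>
    then show "p * q \<in> drazin_invertibles"
      using drazin_invertibles_mult_swap[of "p * q" p] p by (simp add: mult.assoc[symmetric])
  qed
  moreover have "x * (1 - x) \<in> drazin_invertibles"
    if "p * q \<in> drazin_invertibles" "x \<in> drazin_invertibles"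
    using drazin_invertibles_idempotents_difference_square[OF p q] that by (simp add: x_def)
  ultimately show ?thesis
    using c a by blast
qed

end
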